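(* Let $A_n = A_n(h,T)$ be an apex tree with $n \ge 3$. Then the all-negative signature does not maximise the frustration index of $A_n$ uniquely; that is, it is not the case that both $l(-A_n) = l_{\max}(A_n)$ and every signature $\sigma$ of $A_n$ with $l(A_n,\sigma) = l_{\max}(A_n)$ is switching equivalent to the all-negative signature.
   Context: All graphs are finite, simple and undirected. A signed graph $\Sigma=(G,\sigma)$ is a graph $G$ with a signature $\sigma:E(G)\to\{+1,-1\}$. The sign of a cycle is the product of the signs of its edges; $\Sigma$ is balanced if all its cycles are positive. The frustration index $l(\Sigma)$ is the minimum number of edges whose deletion makes $\Sigma$ balanced. $-G$ is $G$ with all edges signed $-1$. $l_{\max}(G)=\max_\sigma l(G,\sigma)$ over all signatures of $G$. Switching $\Sigma$ at a vertex subset $X$ negates the signs of all edges with exactly one endpoint in $X$; two signatures of $G$ are switching equivalent if one is obtained from the other by switching. Apex tree: $A_n(h,T)$ denotes a graph with a vertex $h$ of degree $n$ such that deleting $h$ leaves the tree $T$. Standing assumptions: all leaves of $T$ are neighbours of $h$; the graph is $2$-connected; and every vertex of degree $2$ in the graph is contained in a triangle. *)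

theory Defs
  imports Main "HOL-Library.FuncSet"
begin

datatype 'a graph = Graph (verts: "'a set") (edges: "'a set set")

definition simple_graph :: "'a graph \<Rightarrow> bool" where
  "simple_graph G \<longleftrightarrow>
     finite (verts G) \<and> (\<forall>e\<in>edges G. e \<subseteq> verts G \<and> card e = 2)"

definition degree :: "'a graph \<Rightarrow> 'a \<Rightarrow> nat" where
  "degree G v = card {e \<in> edges G. v \<in> e}"

definition del_vert :: "'a graph \<Rightarrow> 'a \<Rightarrow> 'a graph" where
  "del_vert G v = Graph (verts G - {v}) {e \<in> edges G. v \<notin> e}"

definition del_edges :: "'a graph \<Rightarrow> 'a set set \<Rightarrow> 'a graph" where
  "del_edges G F = Graph (verts G) (edges G - F)"

text \<open>A cycle is given by the list of its vertices in cyclic order, without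
  repeating the starting vertex. Lists that differ by rotation or reversal describe
  the same cycle; length at least 3 makes its edges pairwise distinct.\<close>

definition cycle_edges :: "'a list \<Rightarrow> 'a set set" where
  "cycle_edges p = {{p ! i, p ! (Suc i mod length p)} | i. i < length p}"

definition is_cycle :: "'a graph \<Rightarrow> 'a list \<Rightarrow> bool" where
  "is_cycle G p \<longleftrightarrow> 3 \<le> length p \<and> distinct p \<and> cycle_edges p \<subseteq> edges G"

definition connected :: "'a graph \<Rightarrow> bool" where
  "connected G \<longleftrightarrow> verts G \<noteq> {} \<and>
     (\<forall>u\<in>verts G. \<forall>v\<in>verts G. (u, v) \<in> {(x, y). {x, y} \<in> edges G}\<^sup>*)"

definition two_connected :: "'a graph \<Rightarrow> bool" where
  "two_connected G \<longleftrightarrow> 3 \<le> card (verts G) \<and> connected G \<and>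
     (\<forall>v\<in>verts G. connected (del_vert G v))"

definition tree :: "'a graph \<Rightarrow> bool" where
  "tree T \<longleftrightarrow> simple_graph T \<and> connected T \<and> (\<nexists>p. is_cycle T p)"

definition leaf :: "'a graph \<Rightarrow> 'a \<Rightarrow> bool" where
  "leaf T v \<longleftrightarrow> v \<in> verts T \<and> degree T v = 1"

definition in_triangle :: "'a graph \<Rightarrow> 'a \<Rightarrow> bool" where
  "in_triangle G v \<longleftrightarrow> (\<exists>p. is_cycle G p \<and> length p = 3 \<and> v \<in> set p)"

text \<open>\<open>apex_tree n h T G\<close> means that \<open>G\<close> is a graph $A_n(h,T)$. The standing
  assumptions on apex trees (leaves adjacent to \<open>h\<close>, 2-connectedness, triangles at
  vertices of degree 2) are not part of this predicate.\<close>

definition apex_tree :: "nat \<Rightarrow> 'a \<Rightarrow> 'a graph \<Rightarrow> 'a graph \<Rightarrow> bool" where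
  "apex_tree n h T G \<longleftrightarrow> simple_graph G \<and> h \<in> verts G \<and> degree G h = n \<and>
     del_vert G h = T \<and> tree T"

text \<open>A signature of \<open>G\<close> is represented by a total function on vertex sets, of which
  only the values on \<open>edges G\<close> matter. So signatures are compared on \<open>edges G\<close>
  only, and a signature of \<open>G\<close> restricts implicitly to every subgraph of \<open>G\<close>.\<close>

definition signatures :: "'a graph \<Rightarrow> ('a set \<Rightarrow> int) set" where
  "signatures G = edges G \<rightarrow> {1, -1}"

definition all_negative :: "'a set \<Rightarrow> int" where
  "all_negative = (\<lambda>e. -1)"

definition cycle_sign :: "('a set \<Rightarrow> int) \<Rightarrow> 'a list \<Rightarrow> int" where
  "cycle_sign \<sigma> p = (\<Prod>e\<in>cycle_edges p. \<sigma> e)"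

definition balanced :: "'a graph \<Rightarrow> ('a set \<Rightarrow> int) \<Rightarrow> bool" where
  "balanced G \<sigma> \<longleftrightarrow> (\<forall>p. is_cycle G p \<longrightarrow> cycle_sign \<sigma> p = 1)"

definition frustration_index :: "'a graph \<Rightarrow> ('a set \<Rightarrow> int) \<Rightarrow> nat" where
  "frustration_index G \<sigma> =
     Min {card F | F. F \<subseteq> edges G \<and> balanced (del_edges G F) \<sigma>}"

text \<open>The maximum is over a finite nonempty set of values, although \<open>signatures G\<close>
  itself may be infinite: frustration indices are at most \<open>card (edges G)\<close>.\<close>

definition l_max :: "'a graph \<Rightarrow> nat" where
  "l_max G = Max (frustration_index G ` signatures G)"

definition switch :: "'a set \<Rightarrow> ('a set \<Rightarrow> int) \<Rightarrow> 'a set \<Rightarrow> int" where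
  "switch X \<sigma> e = (if card (e \<inter> X) = 1 then - \<sigma> e else \<sigma> e)"

definition switching_equivalent ::
    "'a graph \<Rightarrow> ('a set \<Rightarrow> int) \<Rightarrow> ('a set \<Rightarrow> int) \<Rightarrow> bool" where
  "switching_equivalent G \<sigma> \<tau> \<longleftrightarrow>
     (\<exists>X\<subseteq>verts G. \<forall>e\<in>edges G. \<tau> e = switch X \<sigma> e)"

end

(* Switching makes the tree T positive, so a signature amounts to a two-colouring of the n
   neighbours of h. Deleting the minority among the apex edges shows that every frustration index
   is at most n div 2. Conversely, pair up 2 * (n div 2) neighbours of h so that the total
   distance in T is minimal; then shortest paths joining the pairs are edge-disjoint, because two
   paths with a common edge could be re-paired at smaller total length. Hence every colouring
   that separates each pair attains the bound. Swapping the colours within a single pair gives a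
   second such colouring; for n >= 3 it agrees with the first on some other neighbour of h, so the
   two are not switching equivalent. Thus no maximiser, all-negative or not, is unique. *)

theory Submission
  imports Defs "HOL-Library.Disjoint_Sets"
begin

section \<open>Balance of a signature and vertex potentials (Harary's theorem)\<close>

section \<open>Potentials\<close>

text \<open>This is Harary's switching function: switching at the vertices where \<open>s\<close> is
  -1 makes all of \<open>E\<close> positive. The product over \<open>e\<close> avoids ordering the
  two ends, and bounding the whole range of \<open>s\<close> avoids membership conditions.\<close>

definition potential :: "('a \<Rightarrow> int) \<Rightarrow> ('a set \<Rightarrow> int) \<Rightarrow> 'a set set \<Rightarrow> bool" where
  "potential s \<sigma> E \<longleftrightarrow> range s \<subseteq> {1, -1} \<and> (\<forall>e\<in>E. \<sigma> e = (\<Prod>x\<in>e. s x))"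

lemma potential_square:
  assumes "potential s \<sigma> E"
  shows "s x * s x = 1"
proof -
  have "s x \<in> {1, -1}" using assms unfolding potential_def by blast
  then show ?thesis by auto
qed

lemma potential_edge:
  assumes "potential s \<sigma> E" "{x, y} \<in> E" "x \<noteq> y"
  shows "\<sigma> {x, y} = s x * s y"
  using assms unfolding potential_def by auto

lemma cycle_edges_image:
  "cycle_edges p = (\<lambda>i. {p ! i, p ! (Suc i mod length p)}) ` {..<length p}"
  unfolding cycle_edges_def by auto

lemma Suc_mod_inj:
  assumes "i < n" "j < n" "Suc i mod n = Suc j mod n"
  shows "i = j"
  using assms by (auto simp: mod_Suc split: if_splits)

text \<open>Turns products over the edge set of a cycle into products over positions. Equal edges at
  different positions would be traversed in opposite directions, giving i = i + 2 modulo the length,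
  which length at least 3 excludes.\<close>

lemma cycle_edges_inj:
  assumes "3 \<le> length p" "distinct p"
  shows "inj_on (\<lambda>i. {p ! i, p ! (Suc i mod length p)}) {..<length p}"
proof (rule inj_onI)
  fix i j
  let ?n = "length p"
  assume ij: "i \<in> {..<?n}" "j \<in> {..<?n}"
    and eq: "{p ! i, p ! (Suc i mod ?n)} = {p ! j, p ! (Suc j mod ?n)}"
  have lt: "Suc i mod ?n < ?n" "Suc j mod ?n < ?n" using ij by (auto intro: mod_less_divisor)
  consider "p ! i = p ! j" | "p ! i = p ! (Suc j mod ?n)" "p ! (Suc i mod ?n) = p ! j"
    using eq by (auto simp: doubleton_eq_iff)
  then show "i = j"
  proof cases
    case 1
    then show ?thesis using ij assms nth_eq_iff_index_eq by blast
  next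
    case 2
    then have "i = Suc j mod ?n" "Suc i mod ?n = j"
      using ij lt assms nth_eq_iff_index_eq by blast+
    then show ?thesis using ij assms by (auto simp: mod_Suc split: if_splits)
  qed
qed

text \<open>Every vertex of a cycle is an end of exactly two of its edges, so each value of
  \<open>s\<close> enters the product squared.\<close>

lemma prod_cycle_edges:
  fixes s :: "'a \<Rightarrow> int"
  assumes "3 \<le> length p" "distinct p" "\<And>x. s x * s x = 1"
  shows "(\<Prod>e\<in>cycle_edges p. \<Prod>x\<in>e. s x) = 1"
proof -
  let ?n = "length p"
  have ne: "p ! i \<noteq> p ! (Suc i mod ?n)" if "i < ?n" for i
  proof -
    have "i \<noteq> Suc i mod ?n" "Suc i mod ?n < ?n" using that assms(1) by (auto simp: mod_Suc)
    then show ?thesis using that assms(2) nth_eq_iff_index_eq by blast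
  qed
  have inj: "inj_on (\<lambda>i. Suc i mod ?n) {..<?n}"
    by (rule inj_onI) (auto intro: Suc_mod_inj)
  have "(\<lambda>i. Suc i mod ?n) ` {..<?n} \<subseteq> {..<?n}" by (auto intro: mod_less_divisor)
  then have rot: "(\<lambda>i. Suc i mod ?n) ` {..<?n} = {..<?n}"
    using inj by (simp add: endo_inj_surj)
  have "(\<Prod>e\<in>cycle_edges p. \<Prod>x\<in>e. s x)
      = (\<Prod>i<?n. \<Prod>x\<in>{p ! i, p ! (Suc i mod ?n)}. s x)"
    unfolding cycle_edges_image
    by (subst prod.reindex[OF cycle_edges_inj[OF assms(1,2)]]) simp
  also have "\<dots> = (\<Prod>i<?n. s (p ! i) * s (p ! (Suc i mod ?n)))"
    by (rule prod.cong) (use ne in auto)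
  also have "\<dots> = (\<Prod>i<?n. s (p ! i)) * (\<Prod>i<?n. s (p ! (Suc i mod ?n)))"
    by (rule prod.distrib)
  also have "(\<Prod>i<?n. s (p ! (Suc i mod ?n))) = (\<Prod>i<?n. s (p ! i))"
    using prod.reindex[OF inj, of "\<lambda>i. s (p ! i)"] by (simp add: rot)
  also have "(\<Prod>i<?n. s (p ! i)) * (\<Prod>i<?n. s (p ! i)) = 1"
    by (simp add: assms(3) flip: prod.distrib)
  finally show ?thesis .
qed

lemma potential_imp_balanced:
  assumes "potential s \<sigma> (edges G)"
  shows "balanced G \<sigma>"
  unfolding balanced_def
proof (intro allI impI)
  fix p assume p: "is_cycle G p"
  have "cycle_sign \<sigma> p = (\<Prod>e\<in>cycle_edges p. \<Prod>x\<in>e. s x)"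
    unfolding cycle_sign_def
    by (rule prod.cong) (use p assms in \<open>auto simp: is_cycle_def potential_def\<close>)
  also have "\<dots> = 1"
    using p potential_square[OF assms] by (intro prod_cycle_edges) (auto simp: is_cycle_def)
  finally show "cycle_sign \<sigma> p = 1" .
qed

text \<open>The path grows at its front; if the new vertex already occurs, everything before that
  occurrence is dropped. Distinctness later allows closing the path to a cycle.\<close>

lemma rtrancl_distinct_path:
  assumes "(u, v) \<in> R\<^sup>*"
  shows "\<exists>p. p \<noteq> [] \<and> hd p = u \<and> last p = v \<and> distinct p \<and>
    (\<forall>i. Suc i < length p \<longrightarrow> (p ! i, p ! Suc i) \<in> R)"
  using assms
proof (induction rule: converse_rtrancl_induct)
  case base
  show ?case by (intro exI[of _ "[v]"]) simp
next
  case (step u w)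
  then obtain p where p: "p \<noteq> []" "hd p = w" "last p = v" "distinct p"
    "\<And>i. Suc i < length p \<Longrightarrow> (p ! i, p ! Suc i) \<in> R" by blast
  show ?case
  proof (cases "u \<in> set p")
    case True
    then obtain j where "j < length p" "p ! j = u" by (auto simp: in_set_conv_nth)
    then show ?thesis using p
      by (intro exI[of _ "drop j p"]) (auto simp: hd_drop_conv_nth)
  next
    case False
    have "((u # p) ! i, (u # p) ! Suc i) \<in> R" if "Suc i < length (u # p)" for i
      using that p step.hyps(1) by (cases i) (auto simp: hd_conv_nth)
    then show ?thesis using p False by (intro exI[of _ "u # p"]) auto
  qed
qed

text \<open>The hard half of Harary's theorem, adding one edge at a time. If its ends are already
  joined, it closes a cycle whose positive sign forces the right value; otherwise the potential may
  be negated on one component.\<close>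

theorem balanced_imp_potential:
  assumes "finite E" "\<And>e. e \<in> E \<Longrightarrow> card e = 2" "\<And>e. e \<in> E \<Longrightarrow> \<sigma> e \<in> {1, -1}"
    and "balanced (Graph V E) \<sigma>"
  shows "\<exists>s. potential s \<sigma> E"
  using assms
proof (induction E rule: finite_induct)
  case empty
  show ?case by (intro exI[of _ "\<lambda>_. 1"]) (auto simp: potential_def)
next
  case (insert e E)
  have "balanced (Graph V E) \<sigma>"
    using insert.prems(3) unfolding balanced_def is_cycle_def by auto
  then obtain s where s: "potential s \<sigma> E" using insert by auto
  note sq = potential_square[OF s]
  obtain u v where e: "e = {u, v}" "u \<noteq> v"
    using insert.prems(1) by (metis card_2_iff insertI1)
  let ?R = "{(x, y). {x, y} \<in> E}"
  show ?case
  proof (cases "(u, v) \<in> ?R\<^sup>*")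
    case True
    from rtrancl_distinct_path[OF this] obtain p where p: "p \<noteq> []" "hd p = u" "last p = v"
      "distinct p" "\<And>i. Suc i < length p \<Longrightarrow> {p ! i, p ! Suc i} \<in> E" by auto
    let ?n = "length p"
    have ends: "p ! 0 = u" "p ! (?n - 1) = v"
      using p by (auto simp: hd_conv_nth last_conv_nth)
    have "?n \<noteq> 1" using ends e(2) by auto
    moreover have "?n \<noteq> 2"
    proof
      assume "?n = 2"
      then have "{u, v} \<in> E" using p(5)[of 0] ends by simp
      then show False using insert.hyps e by simp
    qed
    moreover have "?n \<noteq> 0" using p(1) by simp
    ultimately have n3: "3 \<le> ?n" by linarith
    have edge: "{p ! i, p ! (Suc i mod ?n)} \<in> insert e E" if "i < ?n" for i
    proof (cases "Suc i = ?n")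
      case True
      then have "i = ?n - 1" by simp
      then show ?thesis using True ends e by (simp add: insert_commute)
    next
      case False
      then show ?thesis using that p(5)[of i] by simp
    qed
    then have sub: "cycle_edges p \<subseteq> insert e E" unfolding cycle_edges_image by auto
    have "Suc (?n - 1) = ?n" using n3 by simp
    then have "Suc (?n - 1) mod ?n = 0" by simp
    then have "{p ! (?n - 1), p ! (Suc (?n - 1) mod ?n)} = e"
      by (simp only: ends e insert_commute)
    then have ein: "e \<in> cycle_edges p"
      unfolding cycle_edges_image using n3 by (intro image_eqI[of _ _ "?n - 1"]) auto
    have fin: "finite (cycle_edges p)" unfolding cycle_edges_image by simp
    have "cycle_sign \<sigma> p = 1"
      using insert.prems(3) n3 p(4) sub unfolding balanced_def is_cycle_def by auto
    \<comment> \<open>The sign of the cycle is multiplied by the product of the potential over its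
      edges, both being 1. Edges of \<open>E\<close> then contribute the factor 1, which isolates
      the factor of \<open>e\<close>.\<close>
    then have "1 = (\<Prod>f\<in>cycle_edges p. \<sigma> f * (\<Prod>x\<in>f. s x))"
      using prod_cycle_edges[OF n3 p(4), of s] sq
      by (simp add: cycle_sign_def prod.distrib)
    also have "\<dots> = \<sigma> e * (\<Prod>x\<in>e. s x) *
        (\<Prod>f\<in>cycle_edges p - {e}. \<sigma> f * (\<Prod>x\<in>f. s x))"
      using ein fin by (simp add: prod.remove)
    also have "(\<Prod>f\<in>cycle_edges p - {e}. \<sigma> f * (\<Prod>x\<in>f. s x)) = 1"
    proof (rule prod.neutral, rule ballI)
      fix f assume "f \<in> cycle_edges p - {e}"
      then have "f \<in> E" using sub by auto
      then have "\<sigma> f = (\<Prod>x\<in>f. s x)" using s by (auto simp: potential_def)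
      then show "\<sigma> f * (\<Prod>x\<in>f. s x) = 1" by (simp add: sq flip: prod.distrib)
    qed
    finally have "\<sigma> e * (s u * s v) = 1" using e by simp
    moreover have "(s u * s v) * (s u * s v) = 1" using sq[of u] sq[of v] by algebra
    ultimately have "\<sigma> e = s u * s v" by algebra
    then have "potential s \<sigma> (insert e E)" using s e by (auto simp: potential_def)
    then show ?thesis by blast
  next
    case False
    \<comment> \<open>\<open>k\<close> is the error of \<open>s\<close> at \<open>e\<close>.
      Multiplying \<open>s\<close> by \<open>k\<close> on the component of \<open>u\<close>, which
      misses \<open>v\<close>, corrects \<open>e\<close>; an edge of \<open>E\<close> has both ends
      or neither in that component and keeps its product.\<close>
    define k where "k = \<sigma> e * s u * s v"
    define t where "t x = (if (u, x) \<in> ?R\<^sup>* then k * s x else s x)" for x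
    have k: "k \<in> {1, -1}"
    proof -
      have "\<sigma> e \<in> {1, -1}" "s u \<in> {1, -1}" "s v \<in> {1, -1}"
        using insert.prems(2) s by (auto simp: potential_def)
      then show ?thesis unfolding k_def by (elim insertE emptyE) simp_all
    qed
    have kk: "k * k = 1" using k by auto
    have rng: "range t \<subseteq> {1, -1}"
    proof
      fix y assume "y \<in> range t"
      then obtain x where "y = t x" by auto
      moreover have "s x \<in> {1, -1}" using s by (auto simp: potential_def)
      ultimately show "y \<in> {1, -1}" using k unfolding t_def by auto
    qed
    have "\<sigma> f = (\<Prod>x\<in>f. t x)" if f: "f \<in> E" for f
    proof -
      obtain x y where xy: "f = {x, y}" "x \<noteq> y"
        using insert.prems(1) f by (metis card_2_iff insertI2)
      then have "(x, y) \<in> ?R" "(y, x) \<in> ?R" using f by (auto simp: insert_commute)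
      then have "(u, x) \<in> ?R\<^sup>* \<longleftrightarrow> (u, y) \<in> ?R\<^sup>*" by (meson rtrancl.rtrancl_into_rtrancl)
      then have "t x * t y = s x * s y \<or> t x * t y = (k * k) * (s x * s y)"
        unfolding t_def by (simp add: algebra_simps)
      then have "t x * t y = s x * s y" by (simp only: kk) simp
      then show ?thesis using potential_edge[OF s, of x y] xy f by simp
    qed
    moreover have "\<sigma> e = t u * t v"
    proof -
      have "t u * t v = \<sigma> e * (s u * s u) * (s v * s v)"
        using False unfolding t_def k_def by simp
      then show ?thesis by (simp add: sq)
    qed
    ultimately have "potential t \<sigma> (insert e E)" using rng e by (auto simp: potential_def)
    then show ?thesis by blast
  qed
qed

section \<open>Pairings of minimal total distance and edge-disjoint walks\<close>

section \<open>Edge-disjoint matchings\<close>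

definition adj :: "'a set set \<Rightarrow> ('a \<times> 'a) set" where
  "adj E = {(x, y). {x, y} \<in> E}"

text \<open>Graph distance as a function of the unordered pair, so that it can be summed over a set
  of pairs. It is meaningful only when the two ends are joined by a walk.\<close>

definition dist_pair :: "'a set set \<Rightarrow> 'a set \<Rightarrow> nat" where
  "dist_pair E p = (LEAST m. \<exists>x y. p = {x, y} \<and> (x, y) \<in> adj E ^^ m)"

lemma adj_relpow_sym: "(x, y) \<in> adj E ^^ m \<Longrightarrow> (y, x) \<in> adj E ^^ m"
proof (induction m arbitrary: y)
  case (Suc m)
  then obtain z where "(x, z) \<in> adj E ^^ m" "(z, y) \<in> adj E" by auto
  then have "(y, z) \<in> adj E" "(z, x) \<in> adj E ^^ m"
    using Suc.IH by (auto simp: adj_def insert_commute)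
  then show ?case by (rule relpow_Suc_I2)
qed simp

lemma dist_pair_le: "(x, y) \<in> adj E ^^ m \<Longrightarrow> dist_pair E {x, y} \<le> m"
  unfolding dist_pair_def by (rule Least_le) blast

lemma dist_pair_walk:
  assumes "(a, b) \<in> (adj E)\<^sup>*"
  obtains f where "f 0 = a" "f (dist_pair E {a, b}) = b"
    "\<And>i. i < dist_pair E {a, b} \<Longrightarrow> {f i, f (Suc i)} \<in> E"
proof -
  obtain m where "(a, b) \<in> adj E ^^ m" using assms rtrancl_power by blast
  then have "\<exists>x y. {a, b} = {x, y} \<and> (x, y) \<in> adj E ^^ m" by blast
  then have "\<exists>x y. {a, b} = {x, y} \<and> (x, y) \<in> adj E ^^ dist_pair E {a, b}"
    unfolding dist_pair_def by (rule LeastI)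
  then have "(a, b) \<in> adj E ^^ dist_pair E {a, b}"
    by (auto simp: doubleton_eq_iff intro: adj_relpow_sym)
  then show ?thesis using that by (auto simp: relpow_fun_conv adj_def)
qed

lemma walk_segment:
  assumes "i + j \<le> m" "\<And>l. l < m \<Longrightarrow> {f l, f (Suc l)} \<in> E"
  shows "(f i, f (i + j)) \<in> adj E ^^ j"
  using assms(1)
proof (induction j)
  case (Suc j)
  then show ?case using assms(2)[of "i + j"] by (auto simp: adj_def)
qed simp

text \<open>If two shortest walks share an edge, re-pairing their ends saves two steps.\<close>

lemma dist_pair_exchange:
  assumes f: "\<And>l. l < m \<Longrightarrow> {f l, f (Suc l)} \<in> E" and g: "\<And>l. l < k \<Longrightarrow> {g l, g (Suc l)} \<in> E"
    and ij: "i < m" "j < k" and eq: "{f i, f (Suc i)} = {g j, g (Suc j)}"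
  shows "dist_pair E {f 0, g 0} + dist_pair E {f m, g k} < m + k \<or>
    dist_pair E {f 0, g k} + dist_pair E {f m, g 0} < m + k"
proof -
  have f1: "(f 0, f i) \<in> adj E ^^ i" using walk_segment[of 0 i m f E] f ij by simp
  have f2: "(f (Suc i), f m) \<in> adj E ^^ (m - Suc i)"
    using walk_segment[of "Suc i" "m - Suc i" m f E] f ij by simp
  have g1: "(g 0, g j) \<in> adj E ^^ j" using walk_segment[of 0 j k g E] g ij by simp
  have g2: "(g (Suc j), g k) \<in> adj E ^^ (k - Suc j)"
    using walk_segment[of "Suc j" "k - Suc j" k g E] g ij by simp
  have join: "dist_pair E {x, y} \<le> a + b"
    if "(x, z) \<in> adj E ^^ a" "(z, y) \<in> adj E ^^ b" for x y z a b
    using that by (intro dist_pair_le) (auto simp: relpow_add)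
  \<comment> \<open>If the walks cross the shared edge in the same direction, start is joined to
    start and end to end; otherwise each start is joined to the other end. The pieces before and
    after the edge are reused once each, so exactly its two traversals disappear.\<close>
  consider "f i = g j" "f (Suc i) = g (Suc j)" | "f i = g (Suc j)" "f (Suc i) = g j"
    using eq by (auto simp: doubleton_eq_iff)
  then show ?thesis
  proof cases
    case 1
    have "dist_pair E {f 0, g 0} \<le> i + j"
      using join[OF f1] adj_relpow_sym[OF g1] 1 by simp
    moreover have "dist_pair E {f m, g k} \<le> (m - Suc i) + (k - Suc j)"
      using join[OF adj_relpow_sym[OF f2]] g2 1 by simp
    ultimately show ?thesis using ij by linarith
  next
    case 2
    have "dist_pair E {f 0, g k} \<le> i + (k - Suc j)"
      using join[OF f1] g2 2 by simp
    moreover have "dist_pair E {f m, g 0} \<le> (m - Suc i) + j"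
      using join[OF adj_relpow_sym[OF f2]] adj_relpow_sym[OF g1] 2 by simp
    ultimately show ?thesis using ij by linarith
  qed
qed

text \<open>The pairs are arbitrary two-element subsets of \<open>N\<close>, not edges of a
  graph.\<close>

definition matching :: "'a set \<Rightarrow> nat \<Rightarrow> 'a set set \<Rightarrow> bool" where
  "matching N k M \<longleftrightarrow> \<Union>M \<subseteq> N \<and> disjoint M \<and> card M = k \<and> (\<forall>p\<in>M. card p = 2)"

lemma matching_exists:
  assumes "finite N" "2 * k \<le> card N"
  shows "\<exists>M. matching N k M"
  using assms
proof (induction k arbitrary: N)
  case 0
  show ?case by (intro exI[of _ "{}"]) (auto simp: matching_def)
next
  case (Suc k)
  then obtain p where p: "p \<subseteq> N" "card p = 2"
    by (metis (no_types, lifting) dual_order.trans le_add1 mult_2_right mult_Suc_right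
      numeral_2_eq_2 obtain_subset_with_card_n)
  then have "2 * k \<le> card (N - p)" "finite (N - p)"
    using Suc.prems by (auto simp: card_Diff_subset finite_subset)
  then obtain M where M: "matching (N - p) k M" using Suc.IH by blast
  then have Mp: "r \<subseteq> N \<and> r \<inter> p = {}" if "r \<in> M" for r
    using that by (auto simp: matching_def)
  have "finite M"
    using M Suc.prems(1) unfolding matching_def by (meson finite_Diff finite_UnionD finite_subset)
  moreover have "p \<notin> M" using Mp p by force
  ultimately have "matching N (Suc k) (insert p M)"
    using M p Mp by (auto simp: matching_def disjoint_def Int_commute)
  then show ?case ..
qed

text \<open>The last three claims let a sum over the new matching split into the two new pairs and
  the untouched rest. The other re-pairing arises by interchanging \<open>c\<close> and
  \<open>d\<close>.\<close>

lemma matching_exchange: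
  assumes M: "matching N k M" "finite M" and pq: "{a, b} \<in> M" "{c, d} \<in> M" "{a, b} \<noteq> {c, d}"
  shows "matching N k (insert {a, c} (insert {b, d} (M - {{a, b}, {c, d}})))"
    and "{a, c} \<noteq> {b, d}" "{a, c} \<notin> M - {{a, b}, {c, d}}" "{b, d} \<notin> M - {{a, b}, {c, d}}"
proof -
  let ?L = "M - {{a, b}, {c, d}}"
  have ab: "a \<noteq> b" "c \<noteq> d" using M pq by (force simp: matching_def)+
  have "{a, b} \<inter> {c, d} = {}" using M pq by (auto simp: matching_def disjoint_def)
  then have ne: "a \<noteq> c" "a \<noteq> d" "b \<noteq> c" "b \<noteq> d" by auto
  have disj: "r \<inter> {a, b, c, d} = {}" if "r \<in> ?L" for r
  proof -
    have "r \<inter> {a, b} = {}" "r \<inter> {c, d} = {}"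
      using that M pq by (auto simp: matching_def disjoint_def)
    then show ?thesis by auto
  qed
  show 1: "{a, c} \<noteq> {b, d}" using ab ne by (auto simp: doubleton_eq_iff)
  show 2: "{a, c} \<notin> ?L" using disj by blast
  show 3: "{b, d} \<notin> ?L" using disj by blast
  have "card ?L = card M - 2" using M pq by (simp add: card_Diff_subset)
  moreover have "2 \<le> card M"
    using card_mono[of M "{{a, b}, {c, d}}"] M pq by simp
  ultimately have "card (insert {a, c} (insert {b, d} ?L)) = k"
    using 1 2 3 M by (simp add: matching_def)
  moreover have "disjoint (insert {a, c} (insert {b, d} ?L))"
  proof -
    have "disjoint ?L" using M by (auto simp: matching_def disjoint_def)
    then show ?thesis using disj ne ab by (fastforce simp: disjoint_def)
  qed
  moreover have "\<Union>(insert {a, c} (insert {b, d} ?L)) \<subseteq> N"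
    using M pq by (auto simp: matching_def)
  moreover have "\<forall>p\<in>insert {a, c} (insert {b, d} ?L). card p = 2"
    using M ne by (auto simp: matching_def)
  ultimately show "matching N k (insert {a, c} (insert {b, d} ?L))"
    by (simp add: matching_def)
qed

text \<open>\<open>W p\<close> is the edge set of a shortest walk between the members of
  \<open>p\<close>, in a matching of least total distance. Reachability inside \<open>W p\<close> is
  the form suited to potentials: one that is constant along these edges agrees at both ends.\<close>

theorem edge_disjoint_matching:
  assumes fin: "finite N" and conn: "\<And>x y. x \<in> N \<Longrightarrow> y \<in> N \<Longrightarrow> (x, y) \<in> (adj E)\<^sup>*"
    and k: "2 * k \<le> card N"
  shows "\<exists>M W. matching N k M \<and> disjoint_family_on W M \<and> (\<forall>p\<in>M. W p \<subseteq> E) \<and>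
    (\<forall>a b. {a, b} \<in> M \<longrightarrow> (a, b) \<in> (adj (W {a, b}))\<^sup>*)"
proof -
  define cost where "cost M = (\<Sum>p\<in>M. dist_pair E p)" for M
  obtain M where M: "matching N k M" and min: "\<And>M'. matching N k M' \<Longrightarrow> cost M \<le> cost M'"
    using matching_exists[OF fin k] ex_has_least_nat[of "matching N k" _ cost] by blast
  have finM: "finite M"
    using M fin unfolding matching_def by (meson finite_UnionD finite_subset)
  have "\<exists>f. p = {f 0, f (dist_pair E p)} \<and> (\<forall>i<dist_pair E p. {f i, f (Suc i)} \<in> E)"
    if p: "p \<in> M" for p
  proof -
    obtain a b where ab: "p = {a, b}" using M p by (auto simp: matching_def card_2_iff)
    then have "(a, b) \<in> (adj E)\<^sup>*" using M p by (intro conn) (auto simp: matching_def)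
    from dist_pair_walk[OF this] obtain f where "f 0 = a" "f (dist_pair E {a, b}) = b"
      "\<And>i. i < dist_pair E {a, b} \<Longrightarrow> {f i, f (Suc i)} \<in> E" by metis
    then show ?thesis using ab by auto
  qed
  then obtain f where f: "\<And>p. p \<in> M \<Longrightarrow> p = {f p 0, f p (dist_pair E p)}"
    "\<And>p i. p \<in> M \<Longrightarrow> i < dist_pair E p \<Longrightarrow> {f p i, f p (Suc i)} \<in> E"
    by metis
  define W where "W p = {{f p i, f p (Suc i)} | i. i < dist_pair E p}" for p
  have "disjoint_family_on W M"
    unfolding disjoint_family_on_def
  proof (intro ballI impI, rule ccontr)
    fix p q assume pq: "p \<in> M" "q \<in> M" "p \<noteq> q" "W p \<inter> W q \<noteq> {}"
    let ?dp = "dist_pair E p" and ?dq = "dist_pair E q"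
    obtain i j where ij: "i < ?dp" "j < ?dq" "{f p i, f p (Suc i)} = {f q j, f q (Suc j)}"
      using pq(4) unfolding W_def by blast
    \<comment> \<open>\<open>c\<close> and \<open>d\<close> name the ends of \<open>q\<close> in
      either order, so that one argument refutes both outcomes of the exchange: a cheaper re-pairing
      contradicts minimality.\<close>
    have no: False if cd: "q = {c, d}" and less: "dist_pair E {f p 0, c} +
        dist_pair E {f p ?dp, d} < ?dp + ?dq" for c d
    proof -
      let ?a = "f p 0" and ?b = "f p ?dp"
      let ?L = "M - {{?a, ?b}, {c, d}}"
      have mem: "{?a, ?b} \<in> M" "{c, d} \<in> M" "{?a, ?b} \<noteq> {c, d}"
        using pq f(1)[OF pq(1)] cd by auto
      note ex = matching_exchange[OF M finM mem]
      have L: "?L = M - {p, q}" using f(1)[OF pq(1)] cd by simp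
      have "cost M \<le> cost (insert {?a, c} (insert {?b, d} ?L))" by (rule min) (rule ex(1))
      also have "\<dots> = dist_pair E {?a, c} + (dist_pair E {?b, d} + cost ?L)"
        unfolding cost_def using ex(2-4) finM by simp
      also have "\<dots> < ?dp + ?dq + cost (M - {p, q})" using less L by simp
      also have "\<dots> = cost M"
      proof -
        have "M = insert p (insert q (M - {p, q}))" using pq by auto
        then have "cost M = cost (insert p (insert q (M - {p, q})))" by simp
        also have "\<dots> = ?dp + (?dq + cost (M - {p, q}))"
          unfolding cost_def using pq finM by simp
        finally show ?thesis by simp
      qed
      finally show False by simp
    qed
    have q: "q = {f q 0, f q ?dq}" "q = {f q ?dq, f q 0}"
      using f(1)[OF pq(2)] by (auto simp: insert_commute)
    from dist_pair_exchange[OF f(2)[OF pq(1)] f(2)[OF pq(2)] ij]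
    show False using no[OF q(1)] no[OF q(2)] by blast
  qed
  moreover have "\<forall>p\<in>M. W p \<subseteq> E" using f(2) by (auto simp: W_def)
  moreover have "(a, b) \<in> (adj (W {a, b}))\<^sup>*" if ab: "{a, b} \<in> M" for a b
  proof -
    let ?p = "{a, b}"
    have "(f ?p 0, f ?p (0 + dist_pair E ?p)) \<in> adj (W ?p) ^^ dist_pair E ?p"
      by (rule walk_segment[where m = "dist_pair E ?p"]) (auto simp: W_def)
    then have w: "(f ?p 0, f ?p (dist_pair E ?p)) \<in> adj (W ?p) ^^ dist_pair E ?p" by simp
    have "a = f ?p 0 \<and> b = f ?p (dist_pair E ?p) \<or> a = f ?p (dist_pair E ?p) \<and> b = f ?p 0"
      using f(1)[OF ab] by (simp add: doubleton_eq_iff)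
    then have "(a, b) \<in> adj (W ?p) ^^ dist_pair E ?p"
      using w adj_relpow_sym[OF w] by metis
    then show ?thesis using relpow_imp_rtrancl by blast
  qed
  ultimately show ?thesis using M by blast
qed

section \<open>Bounds on the frustration index through potentials, and a switching invariant\<close>

section \<open>Frustration indices\<close>

lemma finite_edges: "simple_graph G \<Longrightarrow> finite (edges G)"
  unfolding simple_graph_def by (meson PowI finite_Pow_iff finite_subset subsetI)

text \<open>Makes \<open>Min\<close> in the definition meaningful; deleting every edge leaves a
  balanced graph.\<close>

lemma frustration_index_set:
  assumes "simple_graph G"
  shows "finite {card F | F. F \<subseteq> edges G \<and> balanced (del_edges G F) \<sigma>}"
    and "{card F | F. F \<subseteq> edges G \<and> balanced (del_edges G F) \<sigma>} \<noteq> {}"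
proof -
  have "{card F | F. F \<subseteq> edges G \<and> balanced (del_edges G F) \<sigma>} \<subseteq> card ` Pow (edges G)"
    by auto
  then show "finite {card F | F. F \<subseteq> edges G \<and> balanced (del_edges G F) \<sigma>}"
    using finite_edges[OF assms] by (meson finite_Pow_iff finite_imageI finite_subset)
  have "balanced (del_edges G (edges G)) \<sigma>"
    by (rule potential_imp_balanced[of "\<lambda>_. 1"]) (auto simp: potential_def del_edges_def)
  then show "{card F | F. F \<subseteq> edges G \<and> balanced (del_edges G F) \<sigma>} \<noteq> {}" by blast
qed

lemma frustration_index_le:
  assumes "simple_graph G" "F \<subseteq> edges G" "potential s \<sigma> (edges G - F)"
  shows "frustration_index G \<sigma> \<le> card F"
proof -
  have "balanced (del_edges G F) \<sigma>"
    using assms(3) by (intro potential_imp_balanced) (simp add: del_edges_def)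
  then show ?thesis
    unfolding frustration_index_def
    using assms(2) by (intro Min_le[OF frustration_index_set(1)[OF assms(1)]]) blast
qed

text \<open>By Harary's theorem every deletion set that leaves a balanced graph leaves a potential,
  so lower bounds can be proved against potentials instead of cycles.\<close>

lemma frustration_index_ge:
  assumes G: "simple_graph G" and \<sigma>: "\<sigma> \<in> signatures G"
    and ge: "\<And>F s. F \<subseteq> edges G \<Longrightarrow> potential s \<sigma> (edges G - F) \<Longrightarrow> k \<le> card F"
  shows "k \<le> frustration_index G \<sigma>"
proof -
  have "k \<le> card F" if F: "F \<subseteq> edges G" "balanced (del_edges G F) \<sigma>" for F
  proof -
    have "\<exists>s. potential s \<sigma> (edges G - F)"
      using G \<sigma> F(2) finite_edges[OF G]
      by (intro balanced_imp_potential[of _ _ "verts G"])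
        (auto simp: simple_graph_def signatures_def del_edges_def)
    then show ?thesis using ge F(1) by blast
  qed
  then show ?thesis
    unfolding frustration_index_def
    using frustration_index_set[OF G, of \<sigma>] by (auto simp: Min_ge_iff)
qed

lemma finite_frustration_indices:
  assumes "simple_graph G"
  shows "finite (frustration_index G ` signatures G)"
proof -
  have "frustration_index G \<tau> \<in> {..card (edges G)}" if "\<tau> \<in> signatures G" for \<tau>
    using frustration_index_le[OF assms, of "edges G" "\<lambda>_. 1" \<tau>]
    by (simp add: potential_def)
  then show ?thesis by (meson finite_atMost finite_subset image_subsetI)
qed

lemma l_max_ge:
  assumes "simple_graph G" "\<sigma> \<in> signatures G"
  shows "frustration_index G \<sigma> \<le> l_max G"
  unfolding l_max_def using finite_frustration_indices[OF assms(1)] assms(2) by simp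

lemma l_max_attained:
  assumes "simple_graph G"
  obtains \<sigma> where "\<sigma> \<in> signatures G" "frustration_index G \<sigma> = l_max G"
proof -
  have "(\<lambda>_. 1) \<in> signatures G" by (simp add: signatures_def)
  then have "l_max G \<in> frustration_index G ` signatures G"
    unfolding l_max_def using finite_frustration_indices[OF assms] by (intro Max_in) auto
  then show ?thesis using that by auto
qed

text \<open>An edge has exactly one end in \<open>X\<close> precisely when the product of its end
  factors is -1, so switching is multiplication by a potential.\<close>

lemma switch_eq:
  assumes "card e = 2"
  shows "switch X \<sigma> e = \<sigma> e * (\<Prod>x\<in>e. if x \<in> X then -1 else 1)"
proof -
  obtain x y where "e = {x, y}" "x \<noteq> y" using assms by (metis card_2_iff)
  then show ?thesis
    by (cases "x \<in> X"; cases "y \<in> X") (auto simp: switch_def Int_insert_left)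
qed

lemma adj_star_const:
  assumes "(x, y) \<in> (adj E)\<^sup>*" "\<And>u v. {u, v} \<in> E \<Longrightarrow> s u = s v"
  shows "s x = s y"
  using assms(1) by (induction rule: rtrancl_induct) (auto simp: adj_def assms(2))

text \<open>The test for inequivalence. With a common switching, both signatures give the same sign
  to the closed walk from \<open>h\<close> through \<open>x\<close> along \<open>E\<close> to
  \<open>y\<close> and back; since \<open>E\<close> is positive in both, only the two apex edges
  count.\<close>

lemma switching_equivalent_common:
  assumes G: "simple_graph G" and conn: "(x, y) \<in> (adj E)\<^sup>*" and E: "E \<subseteq> edges G"
    and one: "\<And>e. e \<in> E \<Longrightarrow> \<sigma> e = 1 \<and> \<sigma>' e = 1"
    and xy: "{h, x} \<in> edges G" "{h, y} \<in> edges G"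
    and sig: "\<sigma> \<in> signatures G" "\<sigma>' \<in> signatures G"
    and eq: "switching_equivalent G \<sigma> \<tau>" "switching_equivalent G \<sigma>' \<tau>"
  shows "\<sigma> {h, x} * \<sigma>' {h, x} = \<sigma> {h, y} * \<sigma>' {h, y}"
proof -
  obtain X Y where XY: "\<And>e. e \<in> edges G \<Longrightarrow> switch X \<sigma> e = switch Y \<sigma>' e"
    using eq unfolding switching_equivalent_def by metis
  \<comment> \<open>\<open>s\<close> is -1 exactly on the symmetric difference of \<open>X\<close>
    and \<open>Y\<close>, the set whose switching carries one signature to the other.\<close>
  define s :: "'a \<Rightarrow> int" where
    "s v = (if v \<in> X then -1 else 1) * (if v \<in> Y then -1 else 1)" for v
  have pm: "s v = 1 \<or> s v = -1" for v unfolding s_def by simp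
  have prod: "\<sigma> {u, v} * \<sigma>' {u, v} = s u * s v" if e: "{u, v} \<in> edges G" for u v
  proof -
    have c: "card {u, v} = 2" using G e by (auto simp: simple_graph_def)
    then have ne: "u \<noteq> v" by auto
    have "\<sigma> {u, v} = 1 \<or> \<sigma> {u, v} = -1"
      using sig(1) e by (auto simp: signatures_def)
    moreover have "\<sigma> {u, v} * ((if u \<in> X then -1 else 1) * (if v \<in> X then -1 else 1))
        = \<sigma>' {u, v} * ((if u \<in> Y then -1 else 1) * (if v \<in> Y then -1 else 1))"
      using XY[OF e] ne by (simp only: switch_eq[OF c]) simp
    ultimately show ?thesis unfolding s_def
      by (cases "u \<in> X"; cases "v \<in> X"; cases "u \<in> Y"; cases "v \<in> Y") auto
  qed
  have "s u = s v" if "{u, v} \<in> E" for u v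
    using prod[of u v] one[OF that] that E pm[of u] pm[of v] by auto
  from adj_star_const[where s = s, OF conn this] have "s x = s y" .
  then show ?thesis using prod xy by metis
qed

section \<open>Frustration of apex trees: the upper bound, its attainment and two maximisers\<close>

section \<open>Apex trees\<close>

locale apex =
  fixes G :: "'a graph" and h :: 'a
  assumes simple: "simple_graph G" and tree: "tree (del_vert G h)"
begin

definition N :: "'a set" where
  "N = {v. {h, v} \<in> edges G}"

definition ET :: "'a set set" where
  "ET = {e \<in> edges G. h \<notin> e}"

lemma not_N: "h \<notin> N"
  using simple by (auto simp: N_def simple_graph_def)

lemma N_subset: "N \<subseteq> verts G - {h}"
  using simple not_N by (auto simp: N_def simple_graph_def)

lemma finite_N: "finite N"
  using simple finite_subset[OF N_subset] by (simp add: simple_graph_def)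

lemma edges_eq: "edges G = ET \<union> (\<lambda>v. {h, v}) ` N"
proof -
  have "e \<in> (\<lambda>v. {h, v}) ` N" if e: "e \<in> edges G" "h \<in> e" for e
  proof -
    obtain x y where "e = {x, y}" using e simple by (auto simp: simple_graph_def card_2_iff)
    then show ?thesis using e by (auto simp: N_def insert_commute)
  qed
  then show ?thesis by (auto simp: ET_def N_def)
qed

lemma inj_apex_edge: "inj_on (\<lambda>v. {h, v}) A"
  by (auto simp: inj_on_def doubleton_eq_iff)

lemma card_N: "card N = degree G h"
proof -
  have "{e \<in> edges G. h \<in> e} = (\<lambda>v. {h, v}) ` N"
    unfolding edges_eq by (auto simp: ET_def)
  then show ?thesis by (simp add: degree_def card_image[OF inj_apex_edge])
qed

lemma N_connected: "x \<in> N \<Longrightarrow> y \<in> N \<Longrightarrow> (x, y) \<in> (adj ET)\<^sup>*"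
  using tree N_subset unfolding tree_def connected_def del_vert_def adj_def ET_def by auto

text \<open>A tree has no cycles, so \<sigma> is vacuously balanced on it and has a potential there.
  Either value at \<open>h\<close> extends it once the disagreeing apex edges are deleted; the two
  sets of disagreeing edges are disjoint, so one has at most half of \<open>N\<close>.\<close>

lemma frustration_index_upper:
  assumes "\<sigma> \<in> signatures G"
  shows "frustration_index G \<sigma> \<le> card N div 2"
proof -
  have "\<exists>s. potential s \<sigma> ET"
    using tree simple finite_edges[OF simple] assms
    by (intro balanced_imp_potential[of _ _ "verts G - {h}"])
      (auto simp: tree_def balanced_def simple_graph_def signatures_def del_vert_def ET_def)
  then obtain s where s: "potential s \<sigma> ET" ..
  \<comment> \<open>\<open>A d\<close> collects the neighbours whose apex edge asks for the value
    \<open>d\<close> at \<open>h\<close>.\<close>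
  define A where "A d = {v \<in> N. \<sigma> {h, v} * s v = d}" for d
  have bound: "frustration_index G \<sigma> \<le> card (A (- d))" if d: "d = 1 \<or> d = -1" for d
  proof -
    have "\<sigma> {h, v} = d * s v" if v: "v \<in> N" "v \<notin> A (- d)" for v
    proof -
      have "\<sigma> {h, v} \<in> {1, -1}" "s v \<in> {1, -1}"
        using v assms s by (auto simp: signatures_def N_def potential_def)
      then show ?thesis using v d by (auto simp: A_def)
    qed
    then have "\<sigma> {h, v} = (\<Prod>x\<in>{h, v}. (s(h := d)) x)" if "v \<in> N" "v \<notin> A (- d)" for v
      using that not_N by (cases "v = h") auto
    moreover have "\<sigma> e = (\<Prod>x\<in>e. (s(h := d)) x)" if e: "e \<in> ET" for e
    proof -
      have "\<sigma> e = (\<Prod>x\<in>e. s x)" using s e by (simp add: potential_def)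
      also have "\<dots> = (\<Prod>x\<in>e. (s(h := d)) x)"
        by (rule prod.cong) (use e in \<open>auto simp: ET_def\<close>)
      finally show ?thesis .
    qed
    moreover have "range (s(h := d)) \<subseteq> {1, -1}" using s d by (auto simp: potential_def)
    ultimately have "potential (s(h := d)) \<sigma> (edges G - (\<lambda>v. {h, v}) ` A (- d))"
      unfolding potential_def edges_eq by blast
    then have "frustration_index G \<sigma> \<le> card ((\<lambda>v. {h, v}) ` A (- d))"
      by (rule frustration_index_le[OF simple, rotated]) (auto simp: A_def N_def)
    then show ?thesis by (simp add: card_image[OF inj_apex_edge])
  qed
  have "card (A 1) + card (A (-1)) = card (A 1 \<union> A (-1))"
    by (rule card_Un_disjoint[symmetric]) (use finite_N in \<open>auto simp: A_def\<close>)
  also have "\<dots> \<le> card N" by (rule card_mono[OF finite_N]) (auto simp: A_def)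
  finally show ?thesis using bound[of 1] bound[of "-1"] by simp
qed

text \<open>The normal form under switching: a positive tree, and apex edges negative exactly
  towards \<open>A\<close>. It is used with \<open>A\<close> inside \<open>N\<close>; then
  \<open>h\<close> is not in \<open>A\<close>, and the test concerns the other end of an apex
  edge.\<close>

definition sig :: "'a set \<Rightarrow> 'a set \<Rightarrow> int" where
  "sig A e = (if h \<in> e \<and> e \<inter> A \<noteq> {} then -1 else 1)"

lemma sig_signature: "sig A \<in> signatures G"
  by (simp add: sig_def signatures_def)

lemma sig_ET: "e \<in> ET \<Longrightarrow> sig A e = 1"
  by (simp add: sig_def ET_def)

lemma sig_apex: "A \<subseteq> N \<Longrightarrow> sig A {h, v} = (if v \<in> A then -1 else 1)"
  using not_N by (auto simp: sig_def)

text \<open>Each matched pair closes up through \<^term>\<open>h\<close> to a negative cycle, and these cycles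
  are edge-disjoint.\<close>

lemma frustration_index_lower:
  assumes M: "matching N k M" and disj: "disjoint_family_on W M" and W: "\<And>p. p \<in> M \<Longrightarrow> W p \<subseteq> ET"
    and conn: "\<And>a b. {a, b} \<in> M \<Longrightarrow> (a, b) \<in> (adj (W {a, b}))\<^sup>*"
    and A: "A \<subseteq> N" "\<And>p. p \<in> M \<Longrightarrow> card (p \<inter> A) = 1"
  shows "k \<le> frustration_index G (sig A)"
proof (rule frustration_index_ge[OF simple sig_signature])
  fix F s assume F: "F \<subseteq> edges G" and s: "potential s (sig A) (edges G - F)"
  define U where "U p = W p \<union> (\<lambda>v. {h, v}) ` p" for p
  have "\<exists>e. e \<in> U p \<inter> F" if p: "p \<in> M" for p
  proof (rule ccontr)
    assume "\<nexists>e. e \<in> U p \<inter> F"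
    then have no: "U p \<inter> F = {}" by blast
    obtain a b where ab: "p = {a, b}" "a \<noteq> b" using M p by (auto simp: matching_def card_2_iff)
    have "a \<in> A \<longleftrightarrow> b \<notin> A"
      using A(2)[OF p] ab by (cases "a \<in> A"; cases "b \<in> A") auto
    moreover have N: "a \<in> N" "b \<in> N" using M p ab by (auto simp: matching_def)
    have ends: "sig A {h, v} = s h * s v" if "v \<in> p" for v
    proof (rule potential_edge[OF s])
      show "{h, v} \<in> edges G - F" "h \<noteq> v"
        using that no N not_N ab by (auto simp: U_def N_def)
    qed
    have "s u = s v" if e: "{u, v} \<in> W p" for u v
    proof -
      have "{u, v} \<in> ET" using e W[OF p] by blast
      then have ed: "{u, v} \<in> edges G" by (simp add: ET_def)
      then have "u \<noteq> v" using simple by (auto simp: simple_graph_def)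
      then have "s u * s v = 1"
        using potential_edge[OF s, of u v] ed e no sig_ET[OF \<open>{u, v} \<in> ET\<close>]
        by (auto simp: U_def)
      then show ?thesis using potential_square[OF s, of u] by algebra
    qed
    \<comment> \<open>If nothing of \<open>U p\<close> were deleted, the positive walk would force
      equal values at \<open>a\<close> and \<open>b\<close>, while the apex edges of opposite sign
      force different ones.\<close>
    from adj_star_const[where s = s, OF conn this] have "s a = s b" using p ab by blast
    ultimately show False
      using ends[of a] ends[of b] ab sig_apex[OF A(1)] by (auto split: if_splits)
  qed
  \<comment> \<open>One deleted edge is chosen for each pair; disjointness of the sets
    \<open>U p\<close> makes the choice injective.\<close>
  then obtain g where g: "\<And>p. p \<in> M \<Longrightarrow> g p \<in> U p \<inter> F" by metis
  have disjU: "U p \<inter> U q = {}" if pq: "p \<in> M" "q \<in> M" "p \<noteq> q" for p q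
  proof -
    have "W p \<inter> W q = {}" using disj pq by (simp add: disjoint_family_on_def)
    moreover have "p \<inter> q = {}" using M pq by (auto simp: matching_def disjoint_def)
    then have "(\<lambda>v. {h, v}) ` p \<inter> (\<lambda>v. {h, v}) ` q = {}"
      using inj_on_image_Int[OF inj_apex_edge, of p UNIV q] by auto
    moreover have "W r \<inter> (\<lambda>v. {h, v}) ` r' = {}" if "r \<in> M" for r r'
      using W[OF that] by (auto simp: ET_def)
    from this[OF pq(1), of q] this[OF pq(2), of p]
    have "W p \<inter> (\<lambda>v. {h, v}) ` q = {}" "W q \<inter> (\<lambda>v. {h, v}) ` p = {}" .
    ultimately show ?thesis unfolding U_def by (simp add: Int_Un_distrib Int_Un_distrib2 Int_commute)
  qed
  have "inj_on g M"
  proof (rule inj_onI, rule ccontr)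
    fix p q assume pq: "p \<in> M" "q \<in> M" "g p = g q" "p \<noteq> q"
    then have "g p \<in> U p \<inter> U q" using g[of p] g[of q] by simp
    then show False using disjU[OF pq(1,2,4)] by simp
  qed
  moreover have "g ` M \<subseteq> F" using g by auto
  ultimately have "card M \<le> card F"
    using finite_subset[OF F finite_edges[OF simple]] by (intro card_inj_on_le)
  then show "k \<le> card F" using M by (simp add: matching_def)
qed

text \<open>\<open>A\<close> takes one vertex from each pair of the matching, and \<open>B\<close>
  takes the other one in a single pair \<open>p0\<close>. Both separate every pair, so both reach
  the upper bound.\<close>

theorem two_maximisers:
  assumes n: "3 \<le> card N"
  obtains A B x y where "A \<subseteq> N" "B \<subseteq> N" "x \<in> N" "y \<in> N"
    "(x \<in> A) \<noteq> (x \<in> B)" "(y \<in> A) = (y \<in> B)"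
    "frustration_index G (sig A) = l_max G" "frustration_index G (sig B) = l_max G"
proof -
  let ?k = "card N div 2"
  obtain M W where M: "matching N ?k M" and W: "disjoint_family_on W M" "\<And>p. p \<in> M \<Longrightarrow> W p \<subseteq> ET"
      "\<And>a b. {a, b} \<in> M \<Longrightarrow> (a, b) \<in> (adj (W {a, b}))\<^sup>*"
    using edge_disjoint_matching[OF finite_N N_connected, of ?k] by auto
  have "p \<noteq> {}" if "p \<in> M" for p using M that by (auto simp: matching_def)
  then have "\<And>p. p \<in> M \<Longrightarrow> \<exists>v. v \<in> p" by blast
  then obtain t where t: "\<And>p. p \<in> M \<Longrightarrow> t p \<in> p" by metis
  have sub: "p \<subseteq> N" "card p = 2" if "p \<in> M" for p using M that by (auto simp: matching_def)
  have meet: "p \<inter> q = {}" if "p \<in> M" "q \<in> M" "p \<noteq> q" for p q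
    using M that by (auto simp: matching_def disjoint_def)
  have "card M \<noteq> 0" using M n by (simp add: matching_def)
  then obtain p0 where p0: "p0 \<in> M" by fastforce
  define A where "A = t ` M"
  \<comment> \<open>The symmetric difference with \<open>p0\<close> swaps the two colours in that
    pair and changes nothing elsewhere.\<close>
  define B where "B = (A - p0) \<union> (p0 - A)"
  have inter: "p \<inter> A = {t p}" if "p \<in> M" for p
    using that t meet unfolding A_def by blast
  have AN: "A \<subseteq> N" using t sub unfolding A_def by blast
  have BN: "B \<subseteq> N" using AN sub[OF p0] unfolding B_def by blast
  have cardB: "card (p \<inter> B) = 1" if p: "p \<in> M" for p
  proof (cases "p = p0")
    case True
    have "p \<inter> B = p - {t p}" using inter[OF p] True unfolding B_def by blast
    then show ?thesis using sub[OF p] t[OF p] by simp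
  next
    case False
    have "p \<inter> B = p \<inter> A" using meet[OF p p0 False] unfolding B_def by blast
    then show ?thesis using inter[OF p] by simp
  qed
  have "l_max G \<le> ?k"
    by (rule l_max_attained[OF simple]) (use frustration_index_upper in force)
  then have max: "frustration_index G (sig C) = l_max G"
    if "C \<subseteq> N" "\<And>p. p \<in> M \<Longrightarrow> card (p \<inter> C) = 1" for C
    using frustration_index_lower[OF M W that] l_max_ge[OF simple sig_signature, of C] by simp
  have "card p0 < card N" using sub[OF p0] n by simp
  then have "\<not> N \<subseteq> p0" using sub[OF p0] by (metis card_mono card.infinite leD zero_neq_numeral)
  \<comment> \<open>Three neighbours guarantee one outside \<open>p0\<close>. It may be unmatched or
    lie in another pair; in both cases its colour is the same in \<open>A\<close> and
    \<open>B\<close>.\<close>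
  then obtain y where y: "y \<in> N" "y \<notin> p0" by blast
  show ?thesis
  proof (rule that[of A B "t p0" y])
    show "frustration_index G (sig A) = l_max G" by (rule max[OF AN]) (simp add: inter)
    show "frustration_index G (sig B) = l_max G" by (rule max[OF BN cardB])
    show "t p0 \<in> N" using t[OF p0] sub[OF p0] by blast
    show "(t p0 \<in> A) \<noteq> (t p0 \<in> B)" using t[OF p0] unfolding B_def by blast
    show "(y \<in> A) = (y \<in> B)" using y unfolding B_def by blast
  qed (fact AN BN y(1))+
qed

end

theorem theorem17:
  fixes G T :: "'a graph" and h :: 'a and n :: nat
  assumes "apex_tree n h T G"
    and "\<And>v. leaf T v \<Longrightarrow> {h, v} \<in> edges G"
    and "two_connected G"
    and "\<And>v. v \<in> verts G \<Longrightarrow> degree G v = 2 \<Longrightarrow> in_triangle G v"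
    and "n \<ge> 3"
  shows "\<not> (frustration_index G all_negative = l_max G \<and>
            (\<forall>\<sigma>\<in>signatures G. frustration_index G \<sigma> = l_max G \<longrightarrow>
               switching_equivalent G \<sigma> all_negative))"
proof
  assume "frustration_index G all_negative = l_max G \<and>
    (\<forall>\<sigma>\<in>signatures G. frustration_index G \<sigma> = l_max G \<longrightarrow>
       switching_equivalent G \<sigma> all_negative)"
  then have eq: "\<And>\<sigma>. \<sigma> \<in> signatures G \<Longrightarrow> frustration_index G \<sigma> = l_max G \<Longrightarrow>
    switching_equivalent G \<sigma> all_negative" by blast
  interpret apex G h using assms(1) by unfold_locales (auto simp: apex_tree_def)
  have "3 \<le> card N" using assms(1,5) card_N by (simp add: apex_tree_def)
  then obtain A B x y where AB: "A \<subseteq> N" "B \<subseteq> N" "x \<in> N" "y \<in> N"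
    "(x \<in> A) \<noteq> (x \<in> B)" "(y \<in> A) = (y \<in> B)"
    "frustration_index G (sig A) = l_max G" "frustration_index G (sig B) = l_max G"
    by (rule two_maximisers)
  \<comment> \<open>Both maximisers would switch to the all-negative signature, so the invariant
    applies. Yet the product is -1 at \<open>x\<close>, where the colours differ, and 1 at
    \<open>y\<close>, where they agree.\<close>
  have "sig A {h, x} * sig B {h, x} = sig A {h, y} * sig B {h, y}"
  proof (rule switching_equivalent_common[OF simple N_connected[OF AB(3,4)]])
    show "switching_equivalent G (sig A) all_negative" "switching_equivalent G (sig B) all_negative"
      using AB eq sig_signature by blast+
  qed (use AB sig_ET sig_signature in \<open>auto simp: ET_def N_def\<close>)
  then show False using AB by (auto simp: sig_apex split: if_splits)
qed

end
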